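(* Let $R$ be a region of $\mathcal{A}_{m,n}$. (Version 1.) The image $g(R)$ is an open polytope, described by the rectangle equalities and inequalities that it satisfies. They are the following (where $<$ between letters means "appears before in $\pi(R)$"): - $\Delta_{i_1i_2j_1j_2}=0$ if $i_1,i_2<\overline{j}_1,\overline{j}_2$; - $\Delta_{i_1i_2j_1j_2}=0$ if $\overline{j}_1,\overline{j}_2<i_1,i_2$; - $\Delta_{i_1i_2j_1j_2}>0$ if $i_1<\overline{j}_1<i_2<\overline{j}_2$; - $\Delta_{i_1i_2j_1j_2}>0$ if $\overline{j}_1<i_1<\overline{j}_2<i_2$; - $\Delta_{i_1i_2j_1j_2}>0$ if $i_1<\overline{j}_1<i<\overline{j}_2<i_2$ for some $i$; - $\Delta_{i_1i_2j_1j_2}>0$ if $\overline{j}_1<i_1<\overline{j}<i_2<\overline{j}_2$ for some $\overline{j}$; and no others. (Version 2.) The image $g(R)$ consists of those $g\in\mathbb{R}^{m\times n}$ such that $\Delta_{i_1i_2j_1j_2}$ is: - equal to zero if $\Box_{i_1i_2j_1j_2}$ is monochromatic, - positive if $\Box_{i_1i_2j_1j_2}$ is jagged.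
   Context: The map $g:\mathbb{R}^{2(m+n)}\to\mathbb{R}^{m\times n}$ sends $(a,A,b,B)$, with $a,A\in\mathbb{R}^m$ and $b,B\in\mathbb{R}^n$, to the $m\times n$ matrix with entries $g_{ij}=\min(a_i+b_j,\,A_i+B_j)$. Put $x_i=a_i-A_i$ and $y_j=B_j-b_j$. $\mathcal{A}_{m,n}$ is the hyperplane arrangement in $\mathbb{R}^{2(m+n)}$ consisting of the hyperplanes $x_i=y_j$ for $1\le i\le m$, $1\le j\le n$; its regions are the connected components of the complement. Label of a region. Each region $R$ is described uniquely by an ordered partition of the set of letters $\{1,\dots,m,\overline{1},\dots,\overline{n}\}$ into nonempty blocks, each consisting only of positive letters $i$ (representing $x_i$) or only of negative letters $\overline{j}$ (representing $y_j$), with consecutive blocks of opposite sign: the region is the set of points such that $x_i<y_j$ if the block of $i$ precedes the block of $\overline{j}$, and $x_i>y_j$ otherwise. $\pi(R)$ denotes the permutation of the letters obtained by reading the blocks from left to right, with letters in increasing order within each block. Rectangle relations. For a matrix $g\in\mathbb{R}^{m\times n}$, $\Delta_{i_1i_2j_1j_2}=\Delta_{i_1i_2j_1j_2}(g)=g_{i_1j_1}+g_{i_2j_2}-g_{i_1j_2}-g_{i_2j_1}$. A rectangle relation (rectangle equality or inequality) is an equality or inequality comparing some $\Delta_{i_1i_2j_1j_2}$ with $0$. Diagram of $R$. Arrange the $m\times n$ matrix with its rows in the order in which the positive letters appear in $\pi(R)$ and its columns in the order in which the negative letters appear in $\pi(R)$. Color entry $(i,j)$ white if $x_i<y_j$ on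 $R$ (i.e. $i$ appears before $\overline{j}$ in $\pi(R)$), and black if $x_i>y_j$ on $R$. For $i_1$ before $i_2$ and $\overline{j}_1$ before $\overline{j}_2$ in $\pi(R)$ (this is implicitly assumed whenever the symbol is used), $\Box_{i_1i_2j_1j_2}$ is the sub-rectangle of the diagram containing rows $i_1$ through $i_2$ and columns $\overline{j}_1$ through $\overline{j}_2$. It is monochromatic if all its entries have the same color; sliced if it has black and white entries, separated by a single vertical or horizontal line; and jagged otherwise. *)

theory Defs
  imports "HOL-Analysis.Analysis" "HOL-Library.Disjoint_Sets"
begin

text \<open>The index sets \<open>{1..m}\<close> and \<open>{1..n}\<close> are finite linearly ordered types \<open>'m\<close> and \<open>'n\<close>;
  a point of the ambient space of dimension \<open>2 (m + n)\<close> is a tuple \<open>(a, A, b, B)\<close>.\<close>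

type_synonym ('m, 'n) point = "(real ^ 'm) \<times> (real ^ 'm) \<times> (real ^ 'n) \<times> (real ^ 'n)"

definition gmap :: "('m::finite, 'n::finite) point \<Rightarrow> real ^ 'n ^ 'm" where
  "gmap = (\<lambda>(a, A, b, B). \<chi> i j. min (a $ i + b $ j) (A $ i + B $ j))"

definition xcoord :: "('m::finite, 'n::finite) point \<Rightarrow> 'm \<Rightarrow> real" where
  "xcoord = (\<lambda>(a, A, b, B) i. a $ i - A $ i)"

definition ycoord :: "('m::finite, 'n::finite) point \<Rightarrow> 'n \<Rightarrow> real" where
  "ycoord = (\<lambda>(a, A, b, B) j. B $ j - b $ j)"

definition arrangement :: "('m::finite, 'n::finite) point set set" where
  "arrangement = {{p. xcoord p i = ycoord p j} | i j. True}"

definition regions :: "('m::finite, 'n::finite) point set set" where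
  "regions = components (- \<Union> arrangement)"


subsection \<open>The label of a region\<close>

text \<open>\<open>Neg j\<close> is the barred letter.\<close>

datatype ('m, 'n) letter = Pos 'm | Neg 'n

definition block_before :: "'a set list \<Rightarrow> 'a \<Rightarrow> 'a \<Rightarrow> bool" where
  "block_before bs k l \<longleftrightarrow> (\<exists>q < length bs. \<exists>p < q. k \<in> bs ! p \<and> l \<in> bs ! q)"

definition is_label ::
  "('m::finite, 'n::finite) point set \<Rightarrow> ('m, 'n) letter set list \<Rightarrow> bool" where
  "is_label R bs \<longleftrightarrow>
     distinct bs \<and> partition_on UNIV (set bs) \<and>
     (\<forall>X \<in> set bs. X \<subseteq> range Pos \<or> X \<subseteq> range Neg) \<and>
     (\<forall>k. Suc k < length bs \<longrightarrow> (bs ! k \<subseteq> range Pos \<longleftrightarrow> bs ! Suc k \<subseteq> range Neg)) \<and>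
     R = {p. \<forall>i j. if block_before bs (Pos i) (Neg j) then xcoord p i < ycoord p j
                   else xcoord p i > ycoord p j}"

definition label :: "('m::finite, 'n::finite) point set \<Rightarrow> ('m, 'n) letter set list" where
  "label R = (THE bs. is_label R bs)"

text \<open>Every block contains letters of one sign only, so one of the two lists below is empty.\<close>

definition block_list ::
  "('m::{finite,linorder}, 'n::{finite,linorder}) letter set \<Rightarrow> ('m, 'n) letter list" where
  "block_list X = map Pos (sorted_list_of_set {i. Pos i \<in> X}) @
                  map Neg (sorted_list_of_set {j. Neg j \<in> X})"

definition region_perm ::
  "('m::{finite,linorder}, 'n::{finite,linorder}) point set \<Rightarrow> ('m, 'n) letter list" where
  "region_perm R = concat (map block_list (label R))"

definition before ::
  "('m::{finite,linorder}, 'n::{finite,linorder}) letter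
     \<Rightarrow> ('m, 'n) point set \<Rightarrow> ('m, 'n) letter \<Rightarrow> bool"
  (\<open>(_ \<prec>\<^bsub>_\<^esub> _)\<close> [51, 0, 51] 50) where
  "k \<prec>\<^bsub>R\<^esub> l \<longleftrightarrow> (\<exists>q < length (region_perm R). \<exists>p < q. region_perm R ! p = k \<and> region_perm R ! q = l)"

abbreviation before_eq ::
  "('m::{finite,linorder}, 'n::{finite,linorder}) letter
     \<Rightarrow> ('m, 'n) point set \<Rightarrow> ('m, 'n) letter \<Rightarrow> bool"
  (\<open>(_ \<preceq>\<^bsub>_\<^esub> _)\<close> [51, 0, 51] 50) where
  "k \<preceq>\<^bsub>R\<^esub> l \<equiv> k \<prec>\<^bsub>R\<^esub> l \<or> k = l"


subsection \<open>Rectangle relations\<close>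

definition rect_delta :: "real ^ 'n::finite ^ 'm::finite \<Rightarrow> 'm \<Rightarrow> 'm \<Rightarrow> 'n \<Rightarrow> 'n \<Rightarrow> real" where
  "rect_delta G i1 i2 j1 j2 = G $ i1 $ j1 + G $ i2 $ j2 - G $ i1 $ j2 - G $ i2 $ j1"

datatype ('m, 'n) rect_rel =
    Rect_eq 'm 'm 'n 'n
  | Rect_gt 'm 'm 'n 'n
  | Rect_lt 'm 'm 'n 'n
  | Rect_ge 'm 'm 'n 'n
  | Rect_le 'm 'm 'n 'n

primrec rect_holds :: "real ^ 'n::finite ^ 'm::finite \<Rightarrow> ('m, 'n) rect_rel \<Rightarrow> bool" where
  "rect_holds G (Rect_eq i1 i2 j1 j2) \<longleftrightarrow> rect_delta G i1 i2 j1 j2 = 0"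
| "rect_holds G (Rect_gt i1 i2 j1 j2) \<longleftrightarrow> rect_delta G i1 i2 j1 j2 > 0"
| "rect_holds G (Rect_lt i1 i2 j1 j2) \<longleftrightarrow> rect_delta G i1 i2 j1 j2 < 0"
| "rect_holds G (Rect_ge i1 i2 j1 j2) \<longleftrightarrow> rect_delta G i1 i2 j1 j2 \<ge> 0"
| "rect_holds G (Rect_le i1 i2 j1 j2) \<longleftrightarrow> rect_delta G i1 i2 j1 j2 \<le> 0"

definition satisfied_rels :: "(real ^ 'n::finite ^ 'm::finite) set \<Rightarrow> ('m, 'n) rect_rel set" where
  "satisfied_rels S = {r. \<forall>G \<in> S. rect_holds G r}"

inductive_set listed_rels ::
  "('m::{finite,linorder}, 'n::{finite,linorder}) point set \<Rightarrow> ('m, 'n) rect_rel set"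
  for R where
  "\<lbrakk>Pos i1 \<prec>\<^bsub>R\<^esub> Neg j1; Pos i1 \<prec>\<^bsub>R\<^esub> Neg j2; Pos i2 \<prec>\<^bsub>R\<^esub> Neg j1; Pos i2 \<prec>\<^bsub>R\<^esub> Neg j2\<rbrakk>
     \<Longrightarrow> Rect_eq i1 i2 j1 j2 \<in> listed_rels R"
| "\<lbrakk>Neg j1 \<prec>\<^bsub>R\<^esub> Pos i1; Neg j1 \<prec>\<^bsub>R\<^esub> Pos i2; Neg j2 \<prec>\<^bsub>R\<^esub> Pos i1; Neg j2 \<prec>\<^bsub>R\<^esub> Pos i2\<rbrakk>
     \<Longrightarrow> Rect_eq i1 i2 j1 j2 \<in> listed_rels R"
| "\<lbrakk>Pos i1 \<prec>\<^bsub>R\<^esub> Neg j1; Neg j1 \<prec>\<^bsub>R\<^esub> Pos i2; Pos i2 \<prec>\<^bsub>R\<^esub> Neg j2\<rbrakk>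
     \<Longrightarrow> Rect_gt i1 i2 j1 j2 \<in> listed_rels R"
| "\<lbrakk>Neg j1 \<prec>\<^bsub>R\<^esub> Pos i1; Pos i1 \<prec>\<^bsub>R\<^esub> Neg j2; Neg j2 \<prec>\<^bsub>R\<^esub> Pos i2\<rbrakk>
     \<Longrightarrow> Rect_gt i1 i2 j1 j2 \<in> listed_rels R"
| "\<lbrakk>Pos i1 \<prec>\<^bsub>R\<^esub> Neg j1; Neg j1 \<prec>\<^bsub>R\<^esub> Pos i; Pos i \<prec>\<^bsub>R\<^esub> Neg j2; Neg j2 \<prec>\<^bsub>R\<^esub> Pos i2\<rbrakk>
     \<Longrightarrow> Rect_gt i1 i2 j1 j2 \<in> listed_rels R"
| "\<lbrakk>Neg j1 \<prec>\<^bsub>R\<^esub> Pos i1; Pos i1 \<prec>\<^bsub>R\<^esub> Neg j; Neg j \<prec>\<^bsub>R\<^esub> Pos i2; Pos i2 \<prec>\<^bsub>R\<^esub> Neg j2\<rbrakk>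
     \<Longrightarrow> Rect_gt i1 i2 j1 j2 \<in> listed_rels R"

text \<open>Relations that are the same up to renaming indices (such as \<open>\<Delta>\<close> at \<open>i1 i2 j1 j2\<close> being positive
  and \<open>\<Delta>\<close> at \<open>i2 i1 j1 j2\<close> being negative) or that merely weaken \<open>>\<close> or \<open>=\<close> to \<open>\<ge>\<close> are not
  different relations for the purpose of listing; entailment between two single relations covers this.\<close>

definition rect_entails :: "('m::finite, 'n::finite) rect_rel \<Rightarrow> ('m, 'n) rect_rel \<Rightarrow> bool" where
  "rect_entails s r \<longleftrightarrow> (\<forall>G. rect_holds G s \<longrightarrow> rect_holds G r)"

text \<open>These hold for every matrix, for example \<open>\<Delta> = 0\<close> when \<open>i1 = i2\<close>.\<close>

definition rect_trivial :: "('m::finite, 'n::finite) rect_rel \<Rightarrow> bool" where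
  "rect_trivial r \<longleftrightarrow> (\<forall>G. rect_holds G r)"

text \<open>The image of a region satisfies linear equations and is invariant under adding constants to
  rows and columns, so openness is relative to the affine hull and boundedness is not required.\<close>

definition open_polytope :: "'a::euclidean_space set \<Rightarrow> bool" where
  "open_polytope S \<longleftrightarrow> (\<exists>P. polyhedron P \<and> S = rel_interior P)"


subsection \<open>The diagram of a region\<close>

datatype colour = White | Black

primrec has_colour ::
  "('m::finite, 'n::finite) point set \<Rightarrow> 'm \<Rightarrow> 'n \<Rightarrow> colour \<Rightarrow> bool" where
  "has_colour R i j White \<longleftrightarrow> (\<forall>p \<in> R. xcoord p i < ycoord p j)"
| "has_colour R i j Black \<longleftrightarrow> (\<forall>p \<in> R. xcoord p i > ycoord p j)"

definition box_rows ::
  "('m::{finite,linorder}, 'n::{finite,linorder}) point set \<Rightarrow> 'm \<Rightarrow> 'm \<Rightarrow> 'm set" where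
  "box_rows R i1 i2 = {i. Pos i1 \<preceq>\<^bsub>R\<^esub> Pos i \<and> Pos i \<preceq>\<^bsub>R\<^esub> Pos i2}"

definition box_cols ::
  "('m::{finite,linorder}, 'n::{finite,linorder}) point set \<Rightarrow> 'n \<Rightarrow> 'n \<Rightarrow> 'n set" where
  "box_cols R j1 j2 = {j. Neg j1 \<preceq>\<^bsub>R\<^esub> Neg j \<and> Neg j \<preceq>\<^bsub>R\<^esub> Neg j2}"

definition monochromatic ::
  "('m::{finite,linorder}, 'n::{finite,linorder}) point set \<Rightarrow> 'm \<Rightarrow> 'm \<Rightarrow> 'n \<Rightarrow> 'n \<Rightarrow> bool" where
  "monochromatic R i1 i2 j1 j2 \<longleftrightarrow>
     (\<exists>c. \<forall>i \<in> box_rows R i1 i2. \<forall>j \<in> box_cols R j1 j2. has_colour R i j c)"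

text \<open>The separating line runs right after row \<open>k\<close> (horizontal) or right after column \<open>l\<close> (vertical).\<close>

definition sliced ::
  "('m::{finite,linorder}, 'n::{finite,linorder}) point set \<Rightarrow> 'm \<Rightarrow> 'm \<Rightarrow> 'n \<Rightarrow> 'n \<Rightarrow> bool" where
  "sliced R i1 i2 j1 j2 \<longleftrightarrow>
     (\<forall>c. \<exists>i \<in> box_rows R i1 i2. \<exists>j \<in> box_cols R j1 j2. has_colour R i j c) \<and>
     (\<exists>c d. c \<noteq> d \<and>
       ((\<exists>k \<in> box_rows R i1 i2. \<forall>i \<in> box_rows R i1 i2. \<forall>j \<in> box_cols R j1 j2.
           has_colour R i j (if Pos i \<preceq>\<^bsub>R\<^esub> Pos k then c else d)) \<or>
        (\<exists>l \<in> box_cols R j1 j2. \<forall>i \<in> box_rows R i1 i2. \<forall>j \<in> box_cols R j1 j2.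
           has_colour R i j (if Neg j \<preceq>\<^bsub>R\<^esub> Neg l then c else d))))"

definition jagged ::
  "('m::{finite,linorder}, 'n::{finite,linorder}) point set \<Rightarrow> 'm \<Rightarrow> 'm \<Rightarrow> 'n \<Rightarrow> 'n \<Rightarrow> bool" where
  "jagged R i1 i2 j1 j2 \<longleftrightarrow>
     \<not> monochromatic R i1 i2 j1 j2 \<and> \<not> sliced R i1 i2 j1 j2"

end

theory Submission
  imports Defs
begin

text \<open>Inside a region every entry of \<open>g\<close> is \<open>a i + b j\<close> on the white part of the diagram and
  \<open>A i + B j\<close> on the black part, both of which are staircases. The equalities among the rectangle
  relations say exactly that the matrix is additive on each of the two staircases, which recovers
  \<open>a, b, A, B\<close>. For an entry \<open>(i, j)\<close> whose row and column both contain the other colour, a suitable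
  rectangle with that entry as its only white (or black) one has \<open>\<Delta> = \<bar>y j - x i\<bar>\<close>, so the strict
  inequalities put the point into the region. Where the other colour is missing, there is a free
  coordinate that can be chosen large.\<close>

subsection \<open>Labels of regions\<close>

text \<open>\<open>r\<close> is the index of the block: parity records the sign of a letter.\<close>

lemma alternating_rank_exists:
  fixes val :: "'a \<Rightarrow> 'b::linorder" and s :: "'a \<Rightarrow> bool"
  assumes "finite S" and "\<And>k l. \<lbrakk>k \<in> S; l \<in> S; s k \<noteq> s l\<rbrakk> \<Longrightarrow> val k \<noteq> val l"
  shows "\<exists>r K c. r ` S = {..<K::nat} \<and> (\<forall>l\<in>S. s l = (even (r l) = c)) \<and>
           (\<forall>k\<in>S. \<forall>l\<in>S. s k \<noteq> s l \<longrightarrow> (r k < r l \<longleftrightarrow> val k < val l))"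
  using assms
proof (induction S rule: finite_ranking_induct[where f = val])
  case empty
  show ?case by (intro exI[of _ "\<lambda>_. 0"] exI[of _ 0]) auto
next
  case (insert x S)
  then obtain r K c where r: "r ` S = {..<K::nat}" "\<forall>l\<in>S. s l = (even (r l) = c)"
      "\<forall>k\<in>S. \<forall>l\<in>S. s k \<noteq> s l \<longrightarrow> (r k < r l \<longleftrightarrow> val k < val l)"
    by (metis insertI2)
  show ?case
  proof (cases "x \<in> S")
    case True
    then show ?thesis using r by (auto simp: insert_absorb intro!: exI[of _ r] exI[of _ K] exI[of _ c])
  next
    case x: False
    have lt: "r l < K" if "l \<in> S" for l using r(1) that by blast
    have val: "val l < val x" if "l \<in> S" "s l \<noteq> s x" for l
      using insert.hyps(2) insert.prems[of l x] that by force
    have upd: "(r(x := y)) ` insert x S = insert y (r ` S)" for y using x by (auto simp: image_def)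
    \<comment> \<open>The value of \<open>x\<close> is maximal, so \<open>x\<close> may be put into
      block \<open>y\<close> as soon as all letters of the other sign have rank strictly below
      \<open>y\<close>.\<close>
    have extend: ?thesis
      if y: "insert y (r ` S) = {..<K'}" "s x = (even y = c')" "\<And>l. l \<in> S \<Longrightarrow> s l = (even (r l) = c')"
        "\<And>l. \<lbrakk>l \<in> S; s l \<noteq> s x\<rbrakk> \<Longrightarrow> r l < y" for y K' c'
    proof (intro exI conjI ballI impI)
      show "(r(x := y)) ` insert x S = {..<K'}" using upd y(1) by simp
      show "s l = (even ((r(x := y)) l) = c')" if "l \<in> insert x S" for l
        using that y(2,3) by auto
      show "(r(x := y)) k < (r(x := y)) l \<longleftrightarrow> val k < val l"
        if "k \<in> insert x S" "l \<in> insert x S" "s k \<noteq> s l" for k l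
      proof -
        consider "k = x" "l \<in> S" "l \<noteq> x" | "l = x" "k \<in> S" "k \<noteq> x" | "k \<in> S" "l \<in> S" "k \<noteq> x" "l \<noteq> x"
          using \<open>k \<in> insert x S\<close> \<open>l \<in> insert x S\<close> \<open>s k \<noteq> s l\<close> by auto
        then show ?thesis
        proof cases
          case 1
          then show ?thesis using val[of l] y(4)[of l] \<open>s k \<noteq> s l\<close> by (simp add: not_less less_imp_le)
        next
          case 2
          then show ?thesis using val[of k] y(4)[of k] \<open>s k \<noteq> s l\<close> by simp
        next
          case 3
          then show ?thesis using r(3) \<open>s k \<noteq> s l\<close> by simp
        qed
      qed
    qed
    \<comment> \<open>If the top block \<open>K'\<close> has the sign of \<open>x\<close>, then
      \<open>x\<close> joins it, and parity keeps the letters of the other sign below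
      \<open>K'\<close>. Otherwise \<open>x\<close> opens the new block \<open>K\<close>.\<close>
    consider "K = 0" | K' where "K = Suc K'" "s x = (even K' = c)" | K' where "K = Suc K'" "s x \<noteq> (even K' = c)"
      by (cases K) auto
    then show ?thesis
    proof cases
      case 1
      then have "S = {}" using r(1) by auto
      then show ?thesis by (intro exI[of _ "\<lambda>_. 0"] exI[of _ 1] exI[of _ "s x"]) auto
    next
      case 2
      have "r l < K'" if "l \<in> S" "s l \<noteq> s x" for l
        using lt[OF that(1)] r(2) that 2 by (metis less_Suc_eq)
      then show ?thesis using extend[of K' K c] r(1,2) 2 by auto
    next
      case 3
      then show ?thesis using extend[of K "Suc K" c] r(1,2) lt by (auto simp: lessThan_Suc)
    qed
  qed
qed

section \<open>Structure and uniqueness of labels\<close>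

lemma
  assumes "is_label R bs"
  shows is_label_partition: "partition_on UNIV (set bs)"
    and is_label_distinct: "distinct bs"
    and is_label_nonempty: "k < length bs \<Longrightarrow> bs ! k \<noteq> {}"
    and is_label_cover: "\<exists>k < length bs. l \<in> bs ! k"
    and is_label_inj: "\<lbrakk>k < length bs; k' < length bs; l \<in> bs ! k; l \<in> bs ! k'\<rbrakk> \<Longrightarrow> k = k'"
    and is_label_sign: "k < length bs \<Longrightarrow> bs ! k \<subseteq> range Pos \<or> bs ! k \<subseteq> range Neg"
    and is_label_alternate:
      "Suc k < length bs \<Longrightarrow> bs ! k \<subseteq> range Pos \<longleftrightarrow> bs ! Suc k \<subseteq> range Neg"
    and is_label_region: "R = {p. \<forall>i j. if block_before bs (Pos i) (Neg j) then xcoord p i < ycoord p j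
                   else xcoord p i > ycoord p j}"
proof -
  show p: "partition_on UNIV (set bs)" and d: "distinct bs"
    and "Suc k < length bs \<Longrightarrow> bs ! k \<subseteq> range Pos \<longleftrightarrow> bs ! Suc k \<subseteq> range Neg"
    and "k < length bs \<Longrightarrow> bs ! k \<subseteq> range Pos \<or> bs ! k \<subseteq> range Neg"
    and "R = {p. \<forall>i j. if block_before bs (Pos i) (Neg j) then xcoord p i < ycoord p j
                   else xcoord p i > ycoord p j}"
    using assms unfolding is_label_def by auto
  show "k < length bs \<Longrightarrow> bs ! k \<noteq> {}" using p by (metis nth_mem partition_onD3)
  show "\<exists>k < length bs. l \<in> bs ! k" using partition_onD1[OF p] by (metis UNIV_I UnionE in_set_conv_nth)
  show "\<lbrakk>k < length bs; k' < length bs; l \<in> bs ! k; l \<in> bs ! k'\<rbrakk> \<Longrightarrow> k = k'"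
    using partition_onD2[OF p] d disjointD[of "set bs" "bs ! k" "bs ! k'"] nth_eq_iff_index_eq[of bs k k'] by auto
qed

lemma is_label_block_before_iff:
  assumes "is_label R bs" "k < length bs" "k' < length bs" "l \<in> bs ! k" "l' \<in> bs ! k'"
  shows "block_before bs l l' \<longleftrightarrow> k < k'"
  using is_label_inj[OF assms(1)] assms(2-) unfolding block_before_def by (metis order.strict_trans)

text \<open>The downward step of the sign-alternating chains that determine the index of a
  block.\<close>

lemma is_label_opposite:
  assumes "is_label R bs" "Suc k < length bs" "l \<in> bs ! Suc k"
  obtains l' where "l' \<in> bs ! k" "l \<in> range Pos \<longleftrightarrow> l' \<in> range Neg"
proof -
  obtain l' where l': "l' \<in> bs ! k" using is_label_nonempty[OF assms(1), of k] assms(2) by auto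
  have disj: "range Pos \<inter> range Neg = {}" by auto
  have "l \<in> range Pos \<longleftrightarrow> l' \<in> range Neg"
    using is_label_alternate[OF assms(1,2)] is_label_sign[OF assms(1,2)]
      is_label_sign[OF assms(1), of k] assms(2,3) l' disj
    by (smt (verit) Suc_lessD disjoint_iff subsetD)
  with l' show ?thesis by (rule that)
qed

text \<open>Opposite letters never share a block, so one point of the region decides their block
  order in both directions. Any two labels of \<open>R\<close> therefore agree on it.\<close>

lemma is_label_order_iff:
  assumes "is_label R bs" "p \<in> R"
  shows "block_before bs (Pos i) (Neg j) \<longleftrightarrow> xcoord p i < ycoord p j"
    and "block_before bs (Neg j) (Pos i) \<longleftrightarrow> ycoord p j < xcoord p i"
proof -
  show 1: "block_before bs (Pos i) (Neg j) \<longleftrightarrow> xcoord p i < ycoord p j"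
    using assms(2) is_label_region[OF assms(1)] by (auto split: if_splits dest: less_asym)
  obtain k k' where k: "k < length bs" "k' < length bs" "Pos i \<in> bs ! k" "Neg j \<in> bs ! k'"
    using is_label_cover[OF assms(1)] by meson
  have neq: "xcoord p i \<noteq> ycoord p j"
    using is_label_region[OF assms(1)] assms(2) by (metis (mono_tags, lifting) less_irrefl mem_Collect_eq)
  from k have "k \<noteq> k'" using is_label_sign[OF assms(1), of k] by auto
  then show "block_before bs (Neg j) (Pos i) \<longleftrightarrow> ycoord p j < xcoord p i"
    using 1 neq k is_label_block_before_iff[OF assms(1) k(1,2), of "Pos i" "Neg j"]
      is_label_block_before_iff[OF assms(1) k(2,1), of "Neg j" "Pos i"] by auto
qed

text \<open>The index of a block is the length of the longest sign-alternating chain of letters below it, and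
  such chains depend only on the region; hence the label is unique.\<close>

lemma is_label_index_le:
  assumes "is_label R bs" "is_label R cs" "p \<in> R"
    and "k < length bs" "k' < length cs" "l \<in> bs ! k" "l \<in> cs ! k'"
  shows "k \<le> k'"
  using assms(4-)
proof (induction k arbitrary: k' l)
  case (Suc k)
  then obtain l' where l': "l' \<in> bs ! k" "l \<in> range Pos \<longleftrightarrow> l' \<in> range Neg"
    using is_label_opposite[OF assms(1)] by metis
  obtain k'' where k'': "k'' < length cs" "l' \<in> cs ! k''" using is_label_cover[OF assms(2)] by blast
  have "block_before bs l' l"
    using is_label_block_before_iff[OF assms(1), of k "Suc k" l' l] Suc.prems l' by auto
  moreover have "(\<exists>i j. l = Pos i \<and> l' = Neg j) \<or> (\<exists>i j. l = Neg j \<and> l' = Pos i)"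
    using l'(2) by (cases l; cases l') auto
  \<comment> \<open>The order of opposite letters passes from \<open>bs\<close> to \<open>cs\<close>
    through their coordinates at \<open>p\<close>.\<close>
  ultimately have "block_before cs l' l"
    using is_label_order_iff[OF assms(1,3)] is_label_order_iff[OF assms(2,3)] by auto
  then have "k'' < k'" using is_label_block_before_iff[OF assms(2)] k'' Suc.prems by blast
  moreover have "k \<le> k''" using Suc.IH[OF _ k''(1) l'(1) k''(2)] Suc.prems by auto
  ultimately show ?case by simp
qed simp

lemma is_label_unique:
  assumes "is_label R bs" "is_label R cs" "p \<in> R"
  shows "bs = cs"
proof -
  have le: "length ds \<le> length es \<and> (\<forall>k < length ds. ds ! k \<subseteq> es ! k)"
    if "is_label R ds" "is_label R es" for ds es
  proof -
    have sub: "k < length es \<and> l \<in> es ! k" if "k < length ds" "l \<in> ds ! k" for k l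
    proof -
      obtain k' where "k' < length es" "l \<in> es ! k'" using is_label_cover[OF \<open>is_label R es\<close>] by blast
      then show ?thesis
        using is_label_index_le[OF \<open>is_label R ds\<close> \<open>is_label R es\<close> assms(3)]
          is_label_index_le[OF \<open>is_label R es\<close> \<open>is_label R ds\<close> assms(3)] that
        by (metis le_antisym)
    qed
    then have "k < length es" if "k < length ds" for k
      using is_label_nonempty[OF \<open>is_label R ds\<close> that] that by auto
    then have "length ds \<le> length es" by (meson not_le less_irrefl)
    with sub show ?thesis by blast
  qed
  from le[OF assms(1,2)] le[OF assms(2,1)] show ?thesis
    by (intro nth_equalityI) (auto simp: set_eq_subset)
qed

section \<open>Regions as sign cells and existence of labels\<close>

lemma xcoord_alt: "xcoord p i = fst p $ i - fst (snd p) $ i"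
  and ycoord_alt: "ycoord p j = snd (snd (snd p)) $ j - fst (snd (snd p)) $ j"
  by (auto simp: xcoord_def ycoord_def split: prod.splits)

text \<open>The sign cell of \<open>p\<close> is convex, hence connected, and avoids all
  hyperplanes, so it lies in the component of \<open>p\<close>. Conversely, each
  \<open>ycoord q j - xcoord q i\<close> is continuous and nonzero on the connected set
  \<open>R\<close>, so it keeps its sign there.\<close>

lemma region_eq_sign_cell:
  assumes "R \<in> regions" "p \<in> R"
  shows "R = {q. \<forall>i j. if xcoord p i < ycoord p j then xcoord q i < ycoord q j
                   else xcoord q i > ycoord q j}" (is "_ = ?C")
    and "xcoord p i \<noteq> ycoord p j"
proof -
  have comp: "R \<in> components (- \<Union> arrangement)" using assms(1) by (simp add: regions_def)
  have "R \<subseteq> - \<Union> arrangement" using comp by (rule in_components_subset)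
  then have ne: "xcoord q i \<noteq> ycoord q j" if "q \<in> R" for q i j
    using that unfolding arrangement_def by blast
  then show "xcoord p i \<noteq> ycoord p j" using assms(2) by blast
  have "convex ?C"
  proof -
    have "?C = (\<Inter>i. \<Inter>j. {q. if xcoord p i < ycoord p j then xcoord q i < ycoord q j
                   else xcoord q i > ycoord q j})" by auto
    moreover have "convex {q. if xcoord p i < ycoord p j then xcoord q i < ycoord q j
                   else xcoord q i > ycoord q j}" for i j
    proof -
      have lin: "linear (\<lambda>q::('a, 'b) point. ycoord q j - xcoord q i)"
        by (rule linearI) (auto simp: xcoord_alt ycoord_alt algebra_simps)
      have "convex ((\<lambda>q::('a, 'b) point. ycoord q j - xcoord q i) -` {0<..})"
        "convex ((\<lambda>q::('a, 'b) point. ycoord q j - xcoord q i) -` {..<0})"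
        by (intro convex_linear_vimage lin; simp)+
      then show ?thesis by (cases "xcoord p i < ycoord p j") (simp_all add: vimage_def)
    qed
    ultimately show ?thesis by (simp add: convex_INT)
  qed
  then have "connected ?C" by (rule convex_connected)
  moreover have "?C \<subseteq> - \<Union> arrangement" unfolding arrangement_def
    by clarsimp (metis less_irrefl)
  moreover have "p \<in> ?C" using ne[OF assms(2)] by (auto simp: less_le not_less)
  ultimately have "?C \<subseteq> R" using components_maximal[OF comp] assms(2) by blast
  moreover have "R \<subseteq> ?C"
  proof -
    have "xcoord q i < ycoord q j \<longleftrightarrow> xcoord p i < ycoord p j" if "q \<in> R" for q i j
    proof (rule ccontr)
      let ?f = "\<lambda>q::('a, 'b) point. ycoord q j - xcoord q i"
      assume *: "\<not> ?thesis"
      have "continuous_on R ?f" unfolding xcoord_alt ycoord_alt by (intro continuous_intros)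
      then have "connected (?f ` R)" using in_components_connected[OF comp] by (rule connected_continuous_image)
      then have "0 \<in> ?f ` R"
        using * connectedD_interval[of "?f ` R" "?f p" "?f q" 0] connectedD_interval[of "?f ` R" "?f q" "?f p" 0]
          assms(2) that by (auto simp: not_less)
      then obtain q' where "q' \<in> R" "ycoord q' j - xcoord q' i = 0" by force
      with ne[of q' i j] show False by simp
    qed
    then show ?thesis using ne by (auto simp del: not_less) (metis linorder_neqE)+
  qed
  ultimately show "R = ?C" by blast
qed

lemma region_nonempty: "R \<in> regions \<Longrightarrow> R \<noteq> {}"
  unfolding regions_def by (rule in_components_nonempty)

lemma is_label_exists:
  assumes "R \<in> regions"
  shows "\<exists>bs. is_label R bs"
proof -
  obtain p where p: "p \<in> R" using region_nonempty[OF assms] by blast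
  define val where "val l = (case l of Pos i \<Rightarrow> xcoord p i | Neg j \<Rightarrow> ycoord p j)" for l
  have "val k \<noteq> val l" if "(k \<in> range Pos) \<noteq> (l \<in> range Pos)" for k l
    using that region_eq_sign_cell(2)[OF assms p] by (cases k; cases l) (auto simp: val_def dest: sym)
  moreover have "finite (UNIV :: ('a, 'b) letter set)"
  proof (rule finite_subset)
    show "(UNIV :: ('a, 'b) letter set) \<subseteq> range Pos \<union> range Neg" by (metis letter.exhaust UnI1 UnI2 rangeI subsetI)
  qed simp
  ultimately obtain r K c where r: "range r = {..<K::nat}" "\<And>l. (l \<in> range Pos) = (even (r l) = c)"
      "\<And>k l. (k \<in> range Pos) \<noteq> (l \<in> range Pos) \<Longrightarrow> r k < r l \<longleftrightarrow> val k < val l"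
    using alternating_rank_exists[of UNIV "\<lambda>l. l \<in> range Pos" val] by auto
  \<comment> \<open>The blocks are the fibres of the rank: being onto \<open>{..<K}\<close> makes
    them nonempty, and parity makes consecutive ones alternate in sign.\<close>
  define bs where "bs = map (\<lambda>k. {l. r l = k}) [0..<K]"
  have nth: "k < K \<Longrightarrow> bs ! k = {l. r l = k}" and len: "length bs = K" for k by (auto simp: bs_def)
  have ne: "k < K \<Longrightarrow> \<exists>l. r l = k" for k using r(1) by (metis imageE lessThan_iff)
  have rK: "r l < K" for l using r(1) by blast
  have NegPos: "l \<in> range Neg \<longleftrightarrow> l \<notin> range Pos" for l :: "('a, 'b) letter" by (cases l) auto
  have bb: "block_before bs k l \<longleftrightarrow> r k < r l" for k l
    unfolding block_before_def len using nth rK by (auto intro: exI[of _ "r l"])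
  have "is_label R bs" unfolding is_label_def
  proof (intro conjI allI ballI impI)
    show "distinct bs" using ne by (fastforce simp: bs_def distinct_map inj_on_def set_eq_iff)
    show "partition_on UNIV (set bs)"
      by (rule partition_onI) (use ne rK in \<open>fastforce simp: bs_def disjnt_def\<close>)+
    show "X \<subseteq> range Pos \<or> X \<subseteq> range Neg" if "X \<in> set bs" for X
      using that r(2) by (auto simp: bs_def NegPos subset_iff)
    show "bs ! k \<subseteq> range Pos \<longleftrightarrow> bs ! Suc k \<subseteq> range Neg" if "Suc k < length bs" for k
      using that ne[of k] ne[of "Suc k"] by (auto simp: len nth NegPos subset_iff r(2))
    show "R = {p. \<forall>i j. if block_before bs (Pos i) (Neg j) then xcoord p i < ycoord p j
                   else xcoord p i > ycoord p j}"
      unfolding bb by (subst region_eq_sign_cell(1)[OF assms p]) (simp add: r(3) val_def image_iff)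
  qed
  then show ?thesis ..
qed

lemma is_label_label:
  assumes "R \<in> regions"
  shows "is_label R (label R)"
proof -
  obtain bs where "is_label R bs" using is_label_exists[OF assms] by blast
  then show ?thesis
    unfolding label_def using region_nonempty[OF assms] is_label_unique by (blast intro: theI)
qed

section \<open>Positions of letters in the permutation\<close>

lemma set_block_list [simp]: "set (block_list X) = X"
proof (rule set_eqI)
  show "l \<in> set (block_list X) \<longleftrightarrow> l \<in> X" for l by (cases l) (auto simp: block_list_def)
qed

lemma distinct_block_list: "distinct (block_list X)"
  by (auto simp: block_list_def distinct_map inj_on_def)

lemma append_nth_before:
  assumes "k \<in> set xs" "l \<in> set ys"
  shows "\<exists>q < length (xs @ ys). \<exists>p < q. (xs @ ys) ! p = k \<and> (xs @ ys) ! q = l"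
proof -
  obtain p q where "p < length xs" "xs ! p = k" "q < length ys" "ys ! q = l"
    using assms by (meson in_set_conv_nth)
  then show ?thesis by (intro exI[of _ "length xs + q"] conjI exI[of _ p]) (auto simp: nth_append)
qed

text \<open>Encodes the order of the letters in \<open>region_perm R\<close> by an injective
  numbering, so that later comparisons of letters are comparisons of natural numbers.\<close>

locale labelled_region =
  fixes R :: "('m::{finite,linorder}, 'n::{finite,linorder}) point set"
    and pos :: "('m, 'n) letter \<Rightarrow> nat"
  assumes inj_pos: "inj pos"
    and before_iff: "k \<prec>\<^bsub>R\<^esub> l \<longleftrightarrow> pos k < pos l"
    and region_eq: "R = {p. \<forall>i j. if pos (Pos i) < pos (Neg j) then xcoord p i < ycoord p j
                              else xcoord p i > ycoord p j}"

text \<open>The blocks partition the letters, so the permutation lists every letter exactly once and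
  positions are well defined. For opposite letters the position order is the block order, which
  fixes the signs on the region.\<close>

lemma labelled_region_exists:
  assumes "R \<in> regions"
  shows "\<exists>pos. labelled_region R pos"
proof -
  obtain p where p: "p \<in> R" using region_nonempty[OF assms] by blast
  note L = is_label_label[OF assms]
  define w where "w = region_perm R"
  have "distinct w"
    unfolding w_def region_perm_def
  proof (rule distinct_concat)
    show "distinct (map block_list (label R))"
      using is_label_distinct[OF L] by (simp add: distinct_map) (metis inj_onI set_block_list)
  next
    fix ys zs assume "ys \<in> set (map block_list (label R))" "zs \<in> set (map block_list (label R))" "ys \<noteq> zs"
    then show "set ys \<inter> set zs = {}"
      using partition_onD2[OF is_label_partition[OF L]] by (auto simp: disjoint_def) (metis disjoint_iff)
  qed (auto simp: distinct_block_list)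
  have "set w = UNIV"
    using partition_onD1[OF is_label_partition[OF L]] by (simp add: w_def region_perm_def)
  have "\<forall>l. \<exists>q < length w. w ! q = l" using \<open>set w = UNIV\<close> by (metis UNIV_I in_set_conv_nth)
  then obtain pos where pos: "\<And>l. pos l < length w" "\<And>l. w ! pos l = l" by metis
  have uniq: "q = pos l" if "q < length w" "w ! q = l" for q l
    using that pos \<open>distinct w\<close> by (metis nth_eq_iff_index_eq)
  have "inj pos" by (rule injI) (metis pos(2))
  have before: "k \<prec>\<^bsub>R\<^esub> l \<longleftrightarrow> pos k < pos l" for k l
    unfolding before_def w_def[symmetric] using pos uniq by (metis order.strict_trans)
  have bb: "pos k < pos l" if "block_before (label R) k l" for k l
  proof -
    from that obtain a b where ab: "b < length (label R)" "a < b" "k \<in> label R ! a" "l \<in> label R ! b"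
      unfolding block_before_def by blast
    \<comment> \<open>Cutting the list of blocks in front of block \<open>b\<close> leaves
      \<open>k\<close> in the first part and \<open>l\<close> in the second.\<close>
    have "label R ! a \<in> set (take b (label R))" "label R ! b \<in> set (drop b (label R))"
      using ab by (auto simp: in_set_conv_nth intro: exI[of _ a] exI[of _ 0])
    then have "k \<in> set (concat (map block_list (take b (label R))))"
      "l \<in> set (concat (map block_list (drop b (label R))))"
      using ab by auto
    from append_nth_before[OF this] show ?thesis
      unfolding before[symmetric] before_def region_perm_def
      by (metis append_take_drop_id concat_append map_append)
  qed
  \<comment> \<open>The two coordinates at \<open>p\<close> differ, so one of the two block orders
    always holds; this supplies the converse of \<open>bb\<close>.\<close>
  have "block_before (label R) (Pos i) (Neg j) \<longleftrightarrow> pos (Pos i) < pos (Neg j)" for i j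
    using is_label_order_iff[OF L p, where i = i and j = j] bb[of "Pos i" "Neg j"] bb[of "Neg j" "Pos i"]
      region_eq_sign_cell(2)[OF assms p, where i = i and j = j] by linarith
  then have "R = {p. \<forall>i j. if pos (Pos i) < pos (Neg j) then xcoord p i < ycoord p j
                              else xcoord p i > ycoord p j}"
    using is_label_region[OF L] by simp
  with \<open>inj pos\<close> before show ?thesis by (auto simp: labelled_region_def)
qed

subsection \<open>The image of a region\<close>

text \<open>The equations hold on the affine hull and the strict inequalities are open conditions,
  so the set is its own relative interior. Its closure is the polyhedron with weak inequalities, and
  a convex set has the same relative interior as its closure.\<close>

lemma open_polytope_linear_system:
  fixes f :: "'i \<Rightarrow> 'a::euclidean_space \<Rightarrow> real"
  assumes fin: "finite E" "finite F" and lin: "\<And>r. linear (f r)"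
    and ne: "{x. (\<forall>r\<in>E. f r x = 0) \<and> (\<forall>r\<in>F. f r x > 0)} \<noteq> {}"
  shows "open_polytope {x. (\<forall>r\<in>E. f r x = 0) \<and> (\<forall>r\<in>F. f r x > 0)}"
proof -
  define L where "L = (\<Inter>r\<in>E. {x. f r x = 0})"
  define U where "U = (\<Inter>r\<in>F. {x. f r x > 0})"
  define K where "K = (\<Inter>r\<in>F. {x. f r x \<ge> 0})"
  define S where "S = {x. (\<forall>r\<in>E. f r x = 0) \<and> (\<forall>r\<in>F. f r x > 0)}"
  have S: "S = L \<inter> U" by (auto simp: S_def L_def U_def)
  obtain s where s: "s \<in> S" using ne by (auto simp: S_def)
  \<comment> \<open>The vector representing \<open>f r\<close>, so that the conditions become
    hyperplanes and half-spaces.\<close>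
  define g where "g r = adjoint (f r) 1" for r
  have inner: "f r x = g r \<bullet> x" for r x
    using adjoint_works[OF lin[of r], of x 1] by (simp add: inner_commute g_def)
  have "polyhedron L" unfolding L_def
    by (rule polyhedron_Inter) (use fin in \<open>auto simp: inner polyhedron_hyperplane\<close>)
  moreover have "polyhedron K" unfolding K_def
    by (rule polyhedron_Inter) (use fin in \<open>auto simp: inner polyhedron_halfspace_ge\<close>)
  ultimately have poly: "polyhedron (L \<inter> K)" by (rule polyhedron_Int)
  have "affine L" unfolding L_def inner using affine_hyperplane by (blast intro: affine_Inter)
  have "open U" unfolding U_def inner using fin by (intro open_INT ballI open_halfspace_gt)
  have "affine hull S \<subseteq> L" using \<open>affine L\<close> by (simp add: S hull_minimal)
  then have "T \<inter> affine hull S \<subseteq> S" if "T = U" for T using that by (auto simp: S)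
  with \<open>open U\<close> have rel: "rel_interior S = S"
    by (auto simp: set_eq_iff mem_rel_interior S)
  have "convex S" unfolding S U_def inner
    using affine_imp_convex[OF \<open>affine L\<close>] by (intro convex_Int convex_INT convex_halfspace_gt)
  have "closure S = L \<inter> K"
  proof
    have "S \<subseteq> L \<inter> K" unfolding S by (auto simp: U_def K_def intro: less_imp_le)
    then show "closure S \<subseteq> L \<inter> K" using poly by (intro closure_minimal polyhedron_imp_closed)
    show "L \<inter> K \<subseteq> closure S"
    proof
      fix x assume x: "x \<in> L \<inter> K"
      \<comment> \<open>Points on the segment from \<open>s\<close> to \<open>x\<close>: the
        positive share of \<open>s\<close> makes every weak inequality strict, and the points tend
        to \<open>x\<close>.\<close>
      define h where "h n = x + (1 / real (Suc n)) *\<^sub>R (s - x)" for n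
      have "h n \<in> S" for n
      proof -
        have h: "f r (h n) = f r x * (real n / Suc n) + f r s / Suc n" for r
          using lin[of r] by (simp add: h_def linear_add linear_diff linear_scale field_simps)
        have "f r (h n) > 0" if "r \<in> F" for r
          unfolding h using x s that by (intro add_nonneg_pos) (auto simp: K_def S_def)
        moreover have "f r (h n) = 0" if "r \<in> E" for r
          unfolding h using x s that by (auto simp: L_def S_def)
        ultimately show ?thesis by (simp add: S_def)
      qed
      moreover have "h \<longlonglongrightarrow> x + 0 *\<^sub>R (s - x)"
        unfolding h_def by (intro tendsto_intros) (rule LIMSEQ_inverse_real_of_nat[unfolded inverse_eq_divide])
      ultimately show "x \<in> closure S" by (auto simp: closure_sequential)
    qed
  qed
  with poly rel \<open>convex S\<close> show ?thesis
    unfolding open_polytope_def S_def[symmetric] by (metis convex_rel_interior_closure)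
qed

lemma finite_family_bounded: "\<exists>N. \<forall>i. \<bar>f i\<bar> \<le> (N::real)" for f :: "'i::finite \<Rightarrow> real"
  by (intro exI[of _ "\<Sum>i\<in>UNIV. \<bar>f i\<bar>"]) (auto intro: member_le_sum)

text \<open>The smallest row and the largest column of a staircase contain all the information, because any
  entry of the staircase spans with them a rectangle that lies inside the staircase.\<close>

lemma staircase_additive:
  fixes G :: "real ^ 'n::finite ^ 'm::finite" and u :: "'m \<Rightarrow> 'a::linorder" and v :: "'n \<Rightarrow> 'a"
  assumes "\<And>i1 i2 j1 j2. \<lbrakk>u i1 < v j1; u i1 < v j2; u i2 < v j1; u i2 < v j2\<rbrakk>
             \<Longrightarrow> rect_delta G i1 i2 j1 j2 = 0"
  obtains a :: "'m \<Rightarrow> real" and b :: "'n \<Rightarrow> real" where "\<And>i j. u i < v j \<Longrightarrow> G $ i $ j = a i + b j"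
proof -
  have "Min (range u) \<in> range u" "Max (range v) \<in> range v" by simp_all
  then obtain i0 j0 where "u i0 = Min (range u)" "v j0 = Max (range v)" by (metis imageE)
  then have "u i0 \<le> u i" "v j \<le> v j0" for i j by simp_all
  then have "rect_delta G i i0 j j0 = 0" if "u i < v j" for i j
    using that by (intro assms) (meson le_less_trans less_le_trans)+
  \<comment> \<open>The equality reads
    \<open>G $ i $ j = G $ i $ j0 + G $ i0 $ j - G $ i0 $ j0\<close>; the constant is absorbed into
    \<open>b\<close>.\<close>
  then show ?thesis
    by (intro that[of "\<lambda>i. G $ i $ j0" "\<lambda>j. G $ i0 $ j - G $ i0 $ j0"])
      (force simp: rect_delta_def)
qed

section \<open>The image as the solution set of the listed relations\<close>

context labelled_region
begin

abbreviation P :: "'m \<Rightarrow> nat" where "P i \<equiv> pos (Pos i)"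
abbreviation N :: "'n \<Rightarrow> nat" where "N j \<equiv> pos (Neg j)"

lemma P_eq_iff [simp]: "P i = P i' \<longleftrightarrow> i = i'" and N_eq_iff [simp]: "N j = N j' \<longleftrightarrow> j = j'"
  and P_neq_N [simp]: "P i \<noteq> N j" and N_neq_P [simp]: "N j \<noteq> P i"
  using inj_pos by (auto dest: injD)

lemma not_P_less_N: "\<not> P i < N j \<longleftrightarrow> N j < P i"
  by (meson P_neq_N not_less_iff_gr_or_eq)

lemma mem_region_iff:
  "p \<in> R \<longleftrightarrow> (\<forall>i j. (P i < N j \<longrightarrow> xcoord p i < ycoord p j) \<and> (N j < P i \<longrightarrow> ycoord p j < xcoord p i))"
  by (subst region_eq) (auto simp: not_P_less_N dest: less_asym)

text \<open>With \<open>A = 0\<close> and \<open>b = 0\<close> the coordinates \<open>x\<close> and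
  \<open>y\<close> can be prescribed freely; the explicit test points below have this form.\<close>

definition realize :: "('m \<Rightarrow> real) \<Rightarrow> ('n \<Rightarrow> real) \<Rightarrow> ('m, 'n) point" where
  "realize x y = (\<chi> i. x i, 0, 0, \<chi> j. y j)"

lemma realize_mem_iff:
  "realize x y \<in> R \<longleftrightarrow> (\<forall>i j. (P i < N j \<longrightarrow> x i < y j) \<and> (N j < P i \<longrightarrow> y j < x i))"
  by (simp add: mem_region_iff xcoord_alt ycoord_alt realize_def)

lemma gmap_realize: "gmap (realize x y) $ i $ j = min (x i) (y j)"
  by (simp add: gmap_def realize_def)

lemma realize_pos_mem: "realize (\<lambda>i. real (P i)) (\<lambda>j. real (N j)) \<in> R"
  by (simp add: realize_mem_iff)

lemma gmap_white: "\<lbrakk>p \<in> R; P i < N j\<rbrakk> \<Longrightarrow> gmap p $ i $ j = fst p $ i + fst (snd (snd p)) $ j"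
  and gmap_black: "\<lbrakk>p \<in> R; N j < P i\<rbrakk> \<Longrightarrow> gmap p $ i $ j = fst (snd p) $ i + snd (snd (snd p)) $ j"
  by (auto simp: mem_region_iff xcoord_alt ycoord_alt gmap_def min_def split: prod.splits; force)+

text \<open>Inserting the white or black sum for each corner cancels everything in the equalities.
  The four strict kinds leave \<open>x i2 - y j1\<close>, \<open>y j2 - x i1\<close>,
  \<open>y j2 - y j1\<close> and \<open>x i2 - x i1\<close>; in the last two the intermediate letter
  supplies the sign, since the region by itself does not compare letters of equal sign.\<close>

lemma image_satisfies_listed:
  assumes "G \<in> gmap ` R" "r \<in> listed_rels R"
  shows "rect_holds G r"
proof -
  obtain p where p: "p \<in> R" "G = gmap p" using assms(1) by blast
  have xy: "P i < N j \<Longrightarrow> xcoord p i < ycoord p j" "N j < P i \<Longrightarrow> ycoord p j < xcoord p i" for i j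
    using p(1) by (auto simp: mem_region_iff)
  note G = gmap_white[OF p(1)] gmap_black[OF p(1)]
  from assms(2) show ?thesis
  proof cases
    case (1 i1 j1 j2 i2) then show ?thesis by (simp add: before_iff p(2) rect_delta_def G)
  next
    case (2 j1 i1 i2 j2) then show ?thesis by (simp add: before_iff p(2) rect_delta_def G)
  next
    case (3 i1 j1 i2 j2)
    then have "P i1 < N j2" "ycoord p j1 < xcoord p i2" using xy by (auto simp: before_iff)
    with 3 show ?thesis by (simp add: before_iff p(2) rect_delta_def G xcoord_alt ycoord_alt)
  next
    case (4 j1 i1 j2 i2)
    then have "N j1 < P i2" "xcoord p i1 < ycoord p j2" using xy by (auto simp: before_iff)
    with 4 show ?thesis by (simp add: before_iff p(2) rect_delta_def G xcoord_alt ycoord_alt)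
  next
    case (5 i1 j1 i j2 i2)
    then have "P i1 < N j2" "N j1 < P i2" "ycoord p j1 < xcoord p i" "xcoord p i < ycoord p j2"
      using xy by (auto simp: before_iff)
    with 5 show ?thesis by (simp add: before_iff p(2) rect_delta_def G xcoord_alt ycoord_alt)
  next
    case (6 j1 i1 j i2 j2)
    then have "P i1 < N j2" "N j1 < P i2" "xcoord p i1 < ycoord p j" "ycoord p j < xcoord p i2"
      using xy by (auto simp: before_iff)
    with 6 show ?thesis by (simp add: before_iff p(2) rect_delta_def G xcoord_alt ycoord_alt)
  qed
qed

text \<open>The white entries determine \<open>a\<close> and \<open>b\<close> and the black ones \<open>A\<close> and \<open>B\<close>, up to a constant each. A row
  or column without entries of one colour leaves the corresponding coordinate free; all free coordinates
  are set to a large \<open>M\<close>.\<close>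

lemma listed_imp_image:
  assumes G: "\<And>r. r \<in> listed_rels R \<Longrightarrow> rect_holds G r"
  shows "G \<in> gmap ` R"
proof -
  obtain a b where ab: "\<And>i j. P i < N j \<Longrightarrow> G $ i $ j = a i + b j"
  proof (rule staircase_additive[of P N G])
    show "rect_delta G i1 i2 j1 j2 = 0" if "P i1 < N j1" "P i1 < N j2" "P i2 < N j1" "P i2 < N j2" for i1 i2 j1 j2
      using G[OF listed_rels.intros(1)] that by (simp add: before_iff)
  qed blast
  \<comment> \<open>Negated positions turn the black staircase into one of the form
    \<open>u i < v j\<close>.\<close>
  obtain A B where AB: "\<And>i j. N j < P i \<Longrightarrow> G $ i $ j = A i + B j"
  proof (rule staircase_additive[of "\<lambda>i. - int (P i)" "\<lambda>j. - int (N j)" G])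
    show "rect_delta G i1 i2 j1 j2 = 0"
      if "- int (P i1) < - int (N j1)" "- int (P i1) < - int (N j2)" "- int (P i2) < - int (N j1)"
        "- int (P i2) < - int (N j2)" for i1 i2 j1 j2
      using G[OF listed_rels.intros(2)] that by (simp add: before_iff)
  qed auto
  obtain K1 K2 K3 K4 where K: "\<And>i. \<bar>a i\<bar> \<le> K1" "\<And>i. \<bar>A i\<bar> \<le> K2" "\<And>j. \<bar>b j\<bar> \<le> K3" "\<And>j. \<bar>B j\<bar> \<le> K4"
    using finite_family_bounded[of a] finite_family_bounded[of A] finite_family_bounded[of b]
      finite_family_bounded[of B] by metis
  \<comment> \<open>So large that \<open>M\<close> plus any original coordinate exceeds every
    \<open>a i + b j\<close> and every \<open>A i + B j\<close>.\<close>
  define M where "M = 3 * (K1 + K2 + K3 + K4) + 1"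
  define a' where "a' i = (if \<exists>j. P i < N j then a i else M)" for i
  define b' where "b' j = (if \<exists>i. P i < N j then b j else M)" for j
  define A' where "A' i = (if \<exists>j. N j < P i then A i else M)" for i
  define B' where "B' j = (if \<exists>i. N j < P i then B j else M)" for j
  have bounds: "\<bar>a i\<bar> \<le> K1" "\<bar>A i\<bar> \<le> K2" "\<bar>b j\<bar> \<le> K3" "\<bar>B j\<bar> \<le> K4"
    "0 \<le> K1" "0 \<le> K2" "0 \<le> K3" "0 \<le> K4" for i j
    using K order_trans[OF abs_ge_zero K(1)] order_trans[OF abs_ge_zero K(2)]
      order_trans[OF abs_ge_zero K(3)] order_trans[OF abs_ge_zero K(4)] by blast+
  have white: "G $ i $ j = a' i + b' j \<and> a' i + b' j < A' i + B' j" if "P i < N j" for i j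
  proof -
    have eq: "a' i = a i" "b' j = b j" using that by (auto simp: a'_def b'_def)
    have "a i + b j < A' i + B' j"
    proof (cases "(\<exists>j'. N j' < P i) \<and> (\<exists>i'. N j < P i')")
      case True
      then obtain i' j' where o: "N j' < P i" "N j < P i'" by blast
      \<comment> \<open>The order is \<open>j' < i < j < i'\<close>. The three black corners combine
        to \<open>A i + B j\<close>, from which the white corner subtracts
        \<open>a i + b j\<close>.\<close>
      have "rect_holds G (Rect_gt i i' j' j)"
        using that o by (intro G listed_rels.intros(4)) (auto simp: before_iff)
      then have "rect_delta G i i' j' j > 0" by simp
      moreover have "N j' < P i'" using that o by linarith
      moreover have "A' i = A i" "B' j = B j" using o by (auto simp: A'_def B'_def)
      ultimately show ?thesis using that o by (simp add: rect_delta_def ab AB)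
    next
      case False
      then show ?thesis
        using bounds(1,2)[of i] bounds(3,4)[of j] bounds(5-) unfolding A'_def B'_def M_def by (auto simp: abs_le_iff)
    qed
    then show ?thesis using that by (simp add: eq ab)
  qed
  have black: "G $ i $ j = A' i + B' j \<and> A' i + B' j < a' i + b' j" if "N j < P i" for i j
  proof -
    have eq: "A' i = A i" "B' j = B j" using that by (auto simp: A'_def B'_def)
    have "A i + B j < a' i + b' j"
    proof (cases "(\<exists>j'. P i < N j') \<and> (\<exists>i'. P i' < N j)")
      case True
      then obtain i' j' where o: "P i < N j'" "P i' < N j" by blast
      have "rect_holds G (Rect_gt i' i j j')"
        using that o by (intro G listed_rels.intros(3)) (auto simp: before_iff)
      then have "rect_delta G i' i j j' > 0" by simp
      moreover have "P i' < N j'" using that o by linarith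
      moreover have "a' i = a i" "b' j = b j" using o by (auto simp: a'_def b'_def)
      ultimately show ?thesis using that o by (simp add: rect_delta_def ab AB)
    next
      case False
      then show ?thesis
        using bounds(1,2)[of i] bounds(3,4)[of j] bounds(5-) unfolding a'_def b'_def M_def by (auto simp: abs_le_iff)
    qed
    then show ?thesis using that by (simp add: eq AB)
  qed
  define p :: "('m, 'n) point" where "p = (\<chi> i. a' i, \<chi> i. A' i, \<chi> j. b' j, \<chi> j. B' j)"
  have "p \<in> R" using white black by (fastforce simp: p_def mem_region_iff xcoord_alt ycoord_alt)
  moreover have "gmap p = G"
  proof -
    have "min (a' i + b' j) (A' i + B' j) = G $ i $ j" for i j
      using white[of i j] black[of j i] by (cases "P i < N j") (auto simp: not_P_less_N min_def)
    then show ?thesis by (simp add: p_def gmap_def vec_eq_iff)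
  qed
  ultimately show ?thesis by blast
qed

lemma image_eq_listed: "gmap ` R = {G. \<forall>r \<in> listed_rels R. rect_holds G r}"
  using image_satisfies_listed listed_imp_image by blast

section \<open>Which rectangle relations hold on the image\<close>

text \<open>The colours of the corners \<open>(i1, j1)\<close> and \<open>(i2, j2)\<close> decide.
  If they agree, one of the first two strict kinds applies. If they differ, either a letter
  separates the columns (or rows), which gives one of the last two kinds, or none does, which is the
  stated alternative.\<close>

lemma rect_gt_listed_cases:
  assumes "P i1 < N j2" "N j1 < P i2"
  shows "Rect_gt i1 i2 j1 j2 \<in> listed_rels R
    \<or> P i1 < N j1 \<and> N j2 < P i2 \<and> (\<forall>i. P i < N j2 \<longrightarrow> P i < N j1)
    \<or> N j1 < P i1 \<and> P i2 < N j2 \<and> (\<forall>j. N j < P i2 \<longrightarrow> N j < P i1)"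
proof -
  note I = listed_rels.intros(3-6)[where R = R, unfolded before_iff]
  consider "P i1 < N j1" "P i2 < N j2" | "N j1 < P i1" "N j2 < P i2" | "P i1 < N j1" "N j2 < P i2" | "N j1 < P i1" "P i2 < N j2"
    using not_P_less_N by blast
  then show ?thesis
  proof cases
    case 1 then show ?thesis using assms I(1) by blast
  next
    case 2 then show ?thesis using assms I(2) by blast
  next
    case 3 then show ?thesis using I(3) not_P_less_N by blast
  next
    case 4 then show ?thesis using I(4) not_P_less_N by blast
  qed
qed

text \<open>Inside a sliced rectangle the two columns (rows) have the same colours everywhere, so their
  \<open>y\<close>-coordinates (\<open>x\<close>-coordinates) may be chosen in either order.\<close>

lemma sliced_columns_attain:
  assumes "P i1 < N j1" "N j2 < P i2" "\<And>i. P i < N j1 \<longleftrightarrow> P i < N j2" "j1 \<noteq> j2" "\<bar>e\<bar> < 1"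
  shows "\<exists>G \<in> gmap ` R. rect_delta G i1 i2 j1 j2 = e"
proof -
  define x where "x i = real (P i)" for i
  \<comment> \<open>Moves \<open>y j1\<close> to offset \<open>e\<close> below \<open>y j2\<close>,
    so that Delta, which is \<open>y j2 - y j1\<close> here, equals \<open>e\<close>. Positions are
    integers, so a shift by less than 1 passes no row letter.\<close>
  define y where "y j = (if j = j1 then real (N j2) - e else real (N j))" for j
  have *: "P i < N j1 \<Longrightarrow> real (P i) < real (N j2) - e" "N j1 < P i \<Longrightarrow> real (N j2) - e < real (P i)" for i
    using assms(3)[of i] assms(5) not_P_less_N[of i] by (fastforce simp: abs_less_iff)+
  then have "realize x y \<in> R" by (auto simp: realize_mem_iff x_def y_def)
  moreover have "rect_delta (gmap (realize x y)) i1 i2 j1 j2 = e"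
    using *(1)[of i1] *(2)[of i2] assms not_P_less_N[of i2]
    by (auto simp: rect_delta_def gmap_realize x_def y_def min_def)
  ultimately show ?thesis by blast
qed

lemma sliced_rows_attain:
  assumes "N j1 < P i1" "P i2 < N j2" "\<And>j. N j < P i1 \<longleftrightarrow> N j < P i2" "i1 \<noteq> i2" "\<bar>e\<bar> < 1"
  shows "\<exists>G \<in> gmap ` R. rect_delta G i1 i2 j1 j2 = e"
proof -
  \<comment> \<open>The same shift for rows: Delta is now \<open>x i2 - x i1\<close>.\<close>
  define x where "x i = (if i = i1 then real (P i2) - e else real (P i))" for i
  define y where "y j = real (N j)" for j
  have *: "N j < P i1 \<Longrightarrow> real (N j) < real (P i2) - e" "P i1 < N j \<Longrightarrow> real (P i2) - e < real (N j)" for j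
    using assms(3)[of j] assms(5) not_P_less_N[of _ j] by (fastforce simp: abs_less_iff)+
  then have "realize x y \<in> R" by (auto simp: realize_mem_iff x_def y_def)
  moreover have "rect_delta (gmap (realize x y)) i1 i2 j1 j2 = e"
    using *(1)[of j1] *(2)[of j2] assms not_P_less_N[of _ j2]
    by (auto simp: rect_delta_def gmap_realize x_def y_def min_def)
  ultimately show ?thesis by blast
qed

text \<open>The three outcomes belong to monochromatic, jagged and sliced rectangles. Only the
  sliced ones leave the sign of Delta undetermined.\<close>

lemma rect_delta_trichotomy_sorted:
  assumes "P i1 < P i2" "N j1 < N j2"
  obtains "Rect_eq i1 i2 j1 j2 \<in> listed_rels R"
  | "Rect_gt i1 i2 j1 j2 \<in> listed_rels R"
  | "\<forall>e. \<bar>e\<bar> < 1 \<longrightarrow> (\<exists>G \<in> gmap ` R. rect_delta G i1 i2 j1 j2 = e)"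
proof -
  \<comment> \<open>With sorted indices, a white corner \<open>(i2, j1)\<close> forces all corners
    white, and a black corner \<open>(i1, j2)\<close> forces all black.\<close>
  consider "P i2 < N j1" | "N j2 < P i1" | "P i1 < N j2" "N j1 < P i2" using not_P_less_N by blast
  then show ?thesis
  proof cases
    case 1
    then show ?thesis using assms by (intro that(1) listed_rels.intros(1)) (auto simp: before_iff)
  next
    case 2
    then show ?thesis using assms by (intro that(1) listed_rels.intros(2)) (auto simp: before_iff)
  next
    case 3
    consider "Rect_gt i1 i2 j1 j2 \<in> listed_rels R"
      | "P i1 < N j1" "N j2 < P i2" "\<And>i. P i < N j2 \<Longrightarrow> P i < N j1"
      | "N j1 < P i1" "P i2 < N j2" "\<And>j. N j < P i2 \<Longrightarrow> N j < P i1"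
      using rect_gt_listed_cases[OF 3] by blast
    then show ?thesis
    proof cases
      case 2
      have "P i < N j1 \<longleftrightarrow> P i < N j2" for i using 2(3) assms(2) by force
      then show ?thesis using assms sliced_columns_attain[OF 2(1,2)] that(3) by blast
    next
      case 3
      have "N j < P i1 \<longleftrightarrow> N j < P i2" for j using 3(3) assms(1) by force
      then show ?thesis using assms sliced_rows_attain[OF 3(1,2)] that(3) by blast
    qed (rule that(2))
  qed
qed

text \<open>Swapping two rows or two columns negates Delta, and a repeated index makes it vanish
  identically, so the sorted case suffices. The negative alternative arises from a single
  swap.\<close>

lemma rect_delta_trichotomy:
  obtains "\<And>G. rect_delta G i1 i2 j1 j2 = 0"
  | s where "s \<in> listed_rels R" "\<And>G. rect_holds G s \<Longrightarrow> rect_delta G i1 i2 j1 j2 = 0"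
  | s where "s \<in> listed_rels R" "\<And>G. rect_holds G s \<Longrightarrow> rect_delta G i1 i2 j1 j2 > 0"
  | s where "s \<in> listed_rels R" "\<And>G. rect_holds G s \<Longrightarrow> rect_delta G i1 i2 j1 j2 < 0"
  | "\<exists>G \<in> gmap ` R. rect_delta G i1 i2 j1 j2 > 0" "\<exists>G \<in> gmap ` R. rect_delta G i1 i2 j1 j2 < 0"
proof -
  note cases = that
  have sorted: thesis
    if "P k1 < P k2" "N l1 < N l2" "c = 1 \<or> c = -1"
      and c: "\<And>G. rect_delta G i1 i2 j1 j2 = c * rect_delta G k1 k2 l1 l2" for k1 k2 l1 l2 c
    using that(1,2)
  proof (cases rule: rect_delta_trichotomy_sorted)
    case 1
    then show ?thesis using c by (intro cases(2)) auto
  next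
    case 2
    from \<open>c = 1 \<or> c = -1\<close> show ?thesis
    proof
      assume "c = 1"
      then show ?thesis using c by (intro cases(3)[OF 2]) auto
    next
      assume "c = -1"
      then show ?thesis using c by (intro cases(4)[OF 2]) auto
    qed
  next
    case 3
    have "\<exists>G \<in> gmap ` R. rect_delta G i1 i2 j1 j2 = e" if "\<bar>e\<bar> < 1" for e
    proof -
      \<comment> \<open>The sign \<open>c\<close> is its own inverse, so the value
        \<open>c * e\<close> on the sorted rectangle produces \<open>e\<close> on the given
        one.\<close>
      have "\<bar>c * e\<bar> < 1" "c * (c * e) = e" using \<open>c = 1 \<or> c = -1\<close> that by auto
      then show ?thesis using 3 c by metis
    qed
    from this[of "1/2"] this[of "-1/2"] show ?thesis by (intro cases(5)) force+
  qed
  consider "i1 = i2 \<or> j1 = j2" | "P i1 < P i2" "N j1 < N j2" | "P i1 < P i2" "N j2 < N j1"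
    | "P i2 < P i1" "N j1 < N j2" | "P i2 < P i1" "N j2 < N j1"
    by (metis P_eq_iff N_eq_iff linorder_neqE_nat)
  then show thesis
  proof cases
    case 1
    then show ?thesis by (intro cases(1)) (auto simp: rect_delta_def)
  next
    case 2
    from sorted[OF this, of 1] show ?thesis by simp
  next
    case 3
    from sorted[OF this, of "-1"] show ?thesis by (simp add: rect_delta_def)
  next
    case 4
    from sorted[OF this, of "-1"] show ?thesis by (simp add: rect_delta_def)
  next
    case 5
    from sorted[OF this, of 1] show ?thesis by (simp add: rect_delta_def)
  qed
qed

text \<open>A rectangle relation only constrains the sign of Delta. Where that sign is constant on
  the image, it is identically zero or forced by a single listed relation; where it is not, both
  signs occur, which no rectangle relation permits.\<close>

lemma satisfied_rels_image:
  "satisfied_rels (gmap ` R) = {r. rect_trivial r \<or> (\<exists>s \<in> listed_rels R. rect_entails s r)}"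
proof (intro equalityI subsetI CollectI)
  fix r assume "r \<in> {r. rect_trivial r \<or> (\<exists>s \<in> listed_rels R. rect_entails s r)}"
  then show "r \<in> satisfied_rels (gmap ` R)"
    using image_satisfies_listed by (auto simp: satisfied_rels_def rect_trivial_def rect_entails_def)
next
  fix r assume r: "r \<in> satisfied_rels (gmap ` R)"
  \<comment> \<open>Treats all five kinds at once: \<open>Q\<close> is a condition on the sign of
    Delta that fails for at least one of the two nonzero signs.\<close>
  have *: "rect_trivial r \<or> (\<exists>s \<in> listed_rels R. rect_entails s r)"
    if d: "\<And>G. rect_holds G r \<longleftrightarrow> Q (rect_delta G i1 i2 j1 j2)"
      and Q: "\<And>x. x > 0 \<Longrightarrow> Q x = Q 1" "\<And>x. x < 0 \<Longrightarrow> Q x = Q (-1)" "\<not> (Q 1 \<and> Q (-1))" for Q i1 i2 j1 j2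
  proof -
    have sat: "Q (rect_delta G i1 i2 j1 j2)" if "G \<in> gmap ` R" for G
      using r that d by (auto simp: satisfied_rels_def)
    \<comment> \<open>One matrix of the image shows that \<open>Q\<close> accepts the sign forced by
      the listed relation.\<close>
    obtain G0 where G0: "G0 \<in> gmap ` R" using realize_pos_mem by blast
    note G0' = sat[OF G0] image_satisfies_listed[OF G0]
    show ?thesis
    proof (cases rule: rect_delta_trichotomy[of i1 i2 j1 j2])
      case 1
      then show ?thesis using G0' by (simp add: rect_trivial_def d)
    next
      case (2 s)
      then show ?thesis using G0' unfolding rect_entails_def d by metis
    next
      case (3 s)
      then show ?thesis using G0' Q unfolding rect_entails_def d by metis
    next
      case (4 s)
      then show ?thesis using G0' Q unfolding rect_entails_def d by metis
    next
      case 5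
      then show ?thesis using sat Q by metis
    qed
  qed
  show "rect_trivial r \<or> (\<exists>s \<in> listed_rels R. rect_entails s r)"
  proof (cases r)
    case (Rect_eq i1 i2 j1 j2)
    show ?thesis by (rule *[of "\<lambda>x. x = 0"]) (auto simp: Rect_eq)
  next
    case (Rect_gt i1 i2 j1 j2)
    show ?thesis by (rule *[of "\<lambda>x. x > 0"]) (auto simp: Rect_gt)
  next
    case (Rect_lt i1 i2 j1 j2)
    show ?thesis by (rule *[of "\<lambda>x. x < 0"]) (auto simp: Rect_lt)
  next
    case (Rect_ge i1 i2 j1 j2)
    show ?thesis by (rule *[of "\<lambda>x. x \<ge> 0"]) (auto simp: Rect_ge)
  next
    case (Rect_le i1 i2 j1 j2)
    show ?thesis by (rule *[of "\<lambda>x. x \<le> 0"]) (auto simp: Rect_le)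
  qed
qed

subsection \<open>The diagram\<close>

text \<open>A colour is a condition on all points of the region, and the point whose coordinates are
  the positions already decides it.\<close>

lemma has_colour_iff: "has_colour R i j White \<longleftrightarrow> P i < N j" "has_colour R i j Black \<longleftrightarrow> N j < P i"
proof -
  have *: "has_colour R i j White \<Longrightarrow> P i < N j" "has_colour R i j Black \<Longrightarrow> N j < P i"
    using realize_pos_mem by (fastforce simp: xcoord_alt ycoord_alt realize_def)+
  then show "has_colour R i j White \<longleftrightarrow> P i < N j" "has_colour R i j Black \<longleftrightarrow> N j < P i"
    by (auto simp: mem_region_iff)
qed

lemma mem_box_iff:
  "i \<in> box_rows R i1 i2 \<longleftrightarrow> P i1 \<le> P i \<and> P i \<le> P i2"
  "j \<in> box_cols R j1 j2 \<longleftrightarrow> N j1 \<le> N j \<and> N j \<le> N j2"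
  by (auto simp: box_rows_def box_cols_def before_iff le_less)

lemma before_eq_iff: "k \<preceq>\<^bsub>R\<^esub> l \<longleftrightarrow> pos k \<le> pos l"
  using inj_pos by (auto simp: before_iff le_less dest: injD)

lemma colour_exhaust_iff: "(\<exists>c. Q c) \<longleftrightarrow> Q White \<or> Q Black"
  by (metis colour.exhaust)

text \<open>Colours form staircases, so the extreme corners decide: \<open>(i2, j1)\<close> is the
  last to be white and \<open>(i1, j2)\<close> the last to be black.\<close>

lemma monochromatic_iff:
  assumes "P i1 < P i2" "N j1 < N j2"
  shows "monochromatic R i1 i2 j1 j2 \<longleftrightarrow> P i2 < N j1 \<or> N j2 < P i1"
proof
  assume "monochromatic R i1 i2 j1 j2"
  then have "(\<forall>i\<in>box_rows R i1 i2. \<forall>j\<in>box_cols R j1 j2. P i < N j)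
      \<or> (\<forall>i\<in>box_rows R i1 i2. \<forall>j\<in>box_cols R j1 j2. N j < P i)"
    by (simp only: monochromatic_def colour_exhaust_iff has_colour_iff)
  moreover have "i1 \<in> box_rows R i1 i2" "i2 \<in> box_rows R i1 i2" "j1 \<in> box_cols R j1 j2" "j2 \<in> box_cols R j1 j2"
    using assms by (auto simp: mem_box_iff)
  ultimately show "P i2 < N j1 \<or> N j2 < P i1" by blast
next
  assume "P i2 < N j1 \<or> N j2 < P i1"
  then have "(\<forall>i\<in>box_rows R i1 i2. \<forall>j\<in>box_cols R j1 j2. P i < N j)
      \<or> (\<forall>i\<in>box_rows R i1 i2. \<forall>j\<in>box_cols R j1 j2. N j < P i)"
    by (force simp: mem_box_iff)
  then show "monochromatic R i1 i2 j1 j2"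
    by (simp only: monochromatic_def colour_exhaust_iff has_colour_iff)
qed

text \<open>By contradiction: if no strict relation is listed, then the outer columns (or rows) have
  equal colours, and a single line separates the colours.\<close>

lemma jagged_imp_listed:
  assumes ord: "P i1 < P i2" "N j1 < N j2" and jag: "jagged R i1 i2 j1 j2"
  shows "Rect_gt i1 i2 j1 j2 \<in> listed_rels R"
proof (rule ccontr)
  assume notin: "Rect_gt i1 i2 j1 j2 \<notin> listed_rels R"
  have ends: "i1 \<in> box_rows R i1 i2" "i2 \<in> box_rows R i1 i2" "j1 \<in> box_cols R j1 j2" "j2 \<in> box_cols R j1 j2"
    using ord by (auto simp: mem_box_iff)
  have mixed: "P i1 < N j2" "N j1 < P i2"
    using jag monochromatic_iff[OF ord] not_P_less_N by (auto simp: jagged_def)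
  have both: "\<forall>c. \<exists>i \<in> box_rows R i1 i2. \<exists>j \<in> box_cols R j1 j2. has_colour R i j c"
  proof
    show "\<exists>i \<in> box_rows R i1 i2. \<exists>j \<in> box_cols R j1 j2. has_colour R i j c" for c
      using mixed ends has_colour_iff by (cases c) blast+
  qed
  from rect_gt_listed_cases[OF mixed] notin
  consider "P i1 < N j1" "N j2 < P i2" "\<And>i. P i < N j2 \<Longrightarrow> P i < N j1"
    | "N j1 < P i1" "P i2 < N j2" "\<And>j. N j < P i2 \<Longrightarrow> N j < P i1" by blast
  then have "sliced R i1 i2 j1 j2"
  proof cases
    case 1
    \<comment> \<open>The horizontal cut runs after the last row that precedes \<open>j1\<close>;
      rows up to \<open>k\<close> are white, later ones black.\<close>
    obtain k where k: "P k < N j1" "\<And>i. P i < N j1 \<Longrightarrow> P i \<le> P k"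
      using ex_has_greatest_nat[of "\<lambda>i. P i < N j1" i1 P "N j1"] 1(1) by blast
    have "k \<in> box_rows R i1 i2" using k 1 ord by (auto simp: mem_box_iff)
    moreover have "has_colour R i j (if P i \<le> P k then White else Black)"
      if "i \<in> box_rows R i1 i2" "j \<in> box_cols R j1 j2" for i j
    proof (cases "P i \<le> P k")
      case True
      then show ?thesis using that k(1) by (simp add: has_colour_iff mem_box_iff del: has_colour.simps)
    next
      case False
      then have "\<not> P i < N j2" using k(2) 1(3) by blast
      then show ?thesis using that False not_P_less_N[of i j2]
        by (simp add: has_colour_iff mem_box_iff del: has_colour.simps)
    qed
    ultimately show ?thesis unfolding sliced_def before_eq_iff using both by (metis colour.distinct(1))
  next
    case 2
    \<comment> \<open>The vertical cut runs after the last column that precedes \<open>i1\<close>;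
      columns up to \<open>l\<close> are black, later ones white.\<close>
    obtain l where l: "N l < P i1" "\<And>j. N j < P i1 \<Longrightarrow> N j \<le> N l"
      using ex_has_greatest_nat[of "\<lambda>j. N j < P i1" j1 N "P i1"] 2(1) by blast
    have "l \<in> box_cols R j1 j2" using l 2 ord by (auto simp: mem_box_iff)
    moreover have "has_colour R i j (if N j \<le> N l then Black else White)"
      if "i \<in> box_rows R i1 i2" "j \<in> box_cols R j1 j2" for i j
    proof (cases "N j \<le> N l")
      case True
      then show ?thesis using that l(1) by (simp add: has_colour_iff mem_box_iff del: has_colour.simps)
    next
      case False
      then have "P i2 < N j" using l(2) 2(3) not_P_less_N by blast
      then show ?thesis using that False
        by (simp add: has_colour_iff mem_box_iff del: has_colour.simps)
    qed
    ultimately show ?thesis unfolding sliced_def before_eq_iff using both by (metis colour.distinct(1))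
  qed
  with jag show False by (simp add: jagged_def)
qed

text \<open>A row with two colours rules out a horizontal cut and a column with two colours a vertical one.\<close>

lemma jaggedI:
  assumes row: "i \<in> box_rows R i1 i2" "j \<in> box_cols R j1 j2" "j' \<in> box_cols R j1 j2" "P i < N j" "N j' < P i"
    and col: "l \<in> box_cols R j1 j2" "k \<in> box_rows R i1 i2" "k' \<in> box_rows R i1 i2" "P k < N l" "N l < P k'"
  shows "jagged R i1 i2 j1 j2"
proof -
  have row': "\<not> (has_colour R i j c \<and> has_colour R i j' c)" for c
    using row(4,5) by (cases c) (auto simp only: has_colour_iff)
  have col': "\<not> (has_colour R k l c \<and> has_colour R k' l c)" for c
    using col(4,5) by (cases c) (auto simp only: has_colour_iff)
  show ?thesis
    unfolding jagged_def monochromatic_def sliced_def using row(1-3) col(1-3) row' col' by metis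
qed

text \<open>Listed equalities may have unsorted or repeated indices and are reduced to sorted
  rectangles by the sign change under swaps. Each listed strict relation is already sorted, and its
  chain of letters exhibits a row and a column with two colours.\<close>

lemma listed_eq_iff_boxes:
  "(\<forall>r \<in> listed_rels R. rect_holds G r) \<longleftrightarrow>
   (\<forall>i1 i2 j1 j2. Pos i1 \<prec>\<^bsub>R\<^esub> Pos i2 \<and> Neg j1 \<prec>\<^bsub>R\<^esub> Neg j2 \<longrightarrow>
           (monochromatic R i1 i2 j1 j2 \<longrightarrow> rect_delta G i1 i2 j1 j2 = 0) \<and>
           (jagged R i1 i2 j1 j2 \<longrightarrow> rect_delta G i1 i2 j1 j2 > 0))" (is "?L \<longleftrightarrow> ?V")
proof
  assume L: ?L
  show ?V
  proof (intro allI impI conjI)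
    fix i1 i2 j1 j2 assume "Pos i1 \<prec>\<^bsub>R\<^esub> Pos i2 \<and> Neg j1 \<prec>\<^bsub>R\<^esub> Neg j2"
    then have ord: "P i1 < P i2" "N j1 < N j2" by (auto simp: before_iff)
    show "rect_delta G i1 i2 j1 j2 = 0" if "monochromatic R i1 i2 j1 j2"
    proof -
      have "P i2 < N j1 \<or> N j2 < P i1" using monochromatic_iff[OF ord] that by simp
      then have "Rect_eq i1 i2 j1 j2 \<in> listed_rels R"
      proof
        assume "P i2 < N j1"
        then show ?thesis using ord by (intro listed_rels.intros(1)) (auto simp: before_iff)
      next
        assume "N j2 < P i1"
        then show ?thesis using ord by (intro listed_rels.intros(2)) (auto simp: before_iff)
      qed
      with L show ?thesis by force
    qed
    show "rect_delta G i1 i2 j1 j2 > 0" if "jagged R i1 i2 j1 j2"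
      using jagged_imp_listed[OF ord that] L by force
  qed
next
  assume V: ?V
  have mono: "rect_delta G i1 i2 j1 j2 = 0" if "P i1 < P i2" "N j1 < N j2" "P i2 < N j1 \<or> N j2 < P i1" for i1 i2 j1 j2
    using V that monochromatic_iff[OF that(1,2)] by (simp add: before_iff)
  have flat: "rect_delta G i1 i2 j1 j2 = 0"
    if "P i1 < N j1 \<and> P i1 < N j2 \<and> P i2 < N j1 \<and> P i2 < N j2 \<or> N j1 < P i1 \<and> N j1 < P i2 \<and> N j2 < P i1 \<and> N j2 < P i2"
    for i1 i2 j1 j2
  proof -
    consider "i1 = i2 \<or> j1 = j2" | "P i1 < P i2" "N j1 < N j2" | "P i1 < P i2" "N j2 < N j1"
      | "P i2 < P i1" "N j1 < N j2" | "P i2 < P i1" "N j2 < N j1"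
      by (metis P_eq_iff N_eq_iff linorder_neqE_nat)
    then show ?thesis
    proof cases
      case 1 then show ?thesis by (auto simp: rect_delta_def)
    next
      case 2 then show ?thesis using mono[OF 2] that by auto
    next
      case 3 then show ?thesis using mono[OF 3] that by (auto simp: rect_delta_def)
    next
      case 4 then show ?thesis using mono[OF 4] that by (auto simp: rect_delta_def)
    next
      case 5 then show ?thesis using mono[OF 5] that by (auto simp: rect_delta_def)
    qed
  qed
  have jag: "rect_delta G i1 i2 j1 j2 > 0" if "P i1 < P i2" "N j1 < N j2" "jagged R i1 i2 j1 j2" for i1 i2 j1 j2
    using V that by (simp add: before_iff)
  show ?L
  proof
    fix r assume "r \<in> listed_rels R"
    then show "rect_holds G r"
    proof cases
      case (1 i1 j1 j2 i2) then show ?thesis using flat[of i1 j1 j2 i2] by (simp add: before_iff)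
    next
      case (2 j1 i1 i2 j2) then show ?thesis using flat[of i1 j1 j2 i2] by (simp add: before_iff)
    next
      case (3 i1 j1 i2 j2)
      have "jagged R i1 i2 j1 j2"
        by (rule jaggedI[of i2 _ _ j2 _ _ j1 j1 i1 i2]) (use 3 in \<open>auto simp: mem_box_iff before_iff\<close>)
      then show ?thesis using 3 jag[of i1 i2 j1 j2] by (simp add: before_iff)
    next
      case (4 j1 i1 j2 i2)
      have "jagged R i1 i2 j1 j2"
        by (rule jaggedI[of i1 _ _ j2 _ _ j1 j2 i1 i2]) (use 4 in \<open>auto simp: mem_box_iff before_iff\<close>)
      then show ?thesis using 4 jag[of i1 i2 j1 j2] by (simp add: before_iff)
    next
      case (5 i1 j1 i j2 i2)
      have "jagged R i1 i2 j1 j2"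
        \<comment> \<open>The separating row \<open>i\<close> is black at \<open>j1\<close> and
          white at \<open>j2\<close>; column \<open>j1\<close> is white at \<open>i1\<close> and
          black at \<open>i2\<close>.\<close>
        by (rule jaggedI[of i _ _ j2 _ _ j1 j1 i1 i2]) (use 5 in \<open>auto simp: mem_box_iff before_iff\<close>)
      then show ?thesis using 5 jag[of i1 i2 j1 j2] by (simp add: before_iff)
    next
      case (6 j1 i1 j i2 j2)
      have "jagged R i1 i2 j1 j2"
        by (rule jaggedI[of i1 _ _ j _ _ j1 j i1 i2]) (use 6 in \<open>auto simp: mem_box_iff before_iff\<close>)
      then show ?thesis using 6 jag[of i1 i2 j1 j2] by (simp add: before_iff)
    qed
  qed
qed

section \<open>The image as an open polytope, and the conclusion\<close>

text \<open>Listed relations are equalities or strict inequalities \<open>> 0\<close> only, so the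
  image is a nonempty solution set of finitely many homogeneous linear conditions.\<close>

lemma open_polytope_image: "open_polytope (gmap ` R)"
proof -
  define f where "f = (\<lambda>(i1 :: 'm, i2, j1 :: 'n, j2) G. rect_delta G i1 i2 j1 j2)"
  define E where "E = {(i1, i2, j1, j2). Rect_eq i1 i2 j1 j2 \<in> listed_rels R}"
  define F where "F = {(i1, i2, j1, j2). Rect_gt i1 i2 j1 j2 \<in> listed_rels R}"
  have holds: "(\<forall>r \<in> listed_rels R. rect_holds G r) \<longleftrightarrow> (\<forall>r\<in>E. f r G = 0) \<and> (\<forall>r\<in>F. f r G > 0)" for G
  proof
    assume "\<forall>r \<in> listed_rels R. rect_holds G r"
    then show "(\<forall>r\<in>E. f r G = 0) \<and> (\<forall>r\<in>F. f r G > 0)" by (force simp: E_def F_def f_def)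
  next
    assume *: "(\<forall>r\<in>E. f r G = 0) \<and> (\<forall>r\<in>F. f r G > 0)"
    show "\<forall>r \<in> listed_rels R. rect_holds G r"
    proof
      fix r assume "r \<in> listed_rels R"
      moreover from this have "(\<exists>i1 i2 j1 j2. r = Rect_eq i1 i2 j1 j2) \<or> (\<exists>i1 i2 j1 j2. r = Rect_gt i1 i2 j1 j2)"
        by cases auto
      ultimately show "rect_holds G r" using * by (auto simp: E_def F_def f_def)
    qed
  qed
  then have eq: "gmap ` R = {G. (\<forall>r\<in>E. f r G = 0) \<and> (\<forall>r\<in>F. f r G > 0)}"
    by (simp add: image_eq_listed)
  show ?thesis
    unfolding eq
  proof (rule open_polytope_linear_system)
    show "linear (f r)" for r
      by (rule linearI) (auto simp: f_def rect_delta_def algebra_simps split: prod.splits)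
    show "{G. (\<forall>r\<in>E. f r G = 0) \<and> (\<forall>r\<in>F. f r G > 0)} \<noteq> {}"
      unfolding eq[symmetric] using realize_pos_mem by blast
  qed simp_all
qed

end

theorem proposition2:
  fixes R :: "('m::{finite,linorder}, 'n::{finite,linorder}) point set"
  assumes "R \<in> regions"
  shows "open_polytope (gmap ` R) \<and>
    (gmap ` R = {G. \<forall>r \<in> satisfied_rels (gmap ` R). rect_holds G r}) \<and>
    (gmap ` R = {G. \<forall>r \<in> listed_rels R. rect_holds G r}) \<and>
    (satisfied_rels (gmap ` R) =
           {r. rect_trivial r \<or> (\<exists>s \<in> listed_rels R. rect_entails s r)}) \<and>
    (gmap ` R = {G. \<forall>i1 i2 j1 j2. Pos i1 \<prec>\<^bsub>R\<^esub> Pos i2 \<and> Neg j1 \<prec>\<^bsub>R\<^esub> Neg j2 \<longrightarrow>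
           (monochromatic R i1 i2 j1 j2 \<longrightarrow> rect_delta G i1 i2 j1 j2 = 0) \<and>
           (jagged R i1 i2 j1 j2 \<longrightarrow> rect_delta G i1 i2 j1 j2 > 0)})"
proof -
  obtain pos where "labelled_region R pos" using labelled_region_exists[OF assms] by blast
  then interpret labelled_region R pos .
  have "gmap ` R = {G. \<forall>r \<in> satisfied_rels (gmap ` R). rect_holds G r}"
  proof
    show "gmap ` R \<subseteq> {G. \<forall>r \<in> satisfied_rels (gmap ` R). rect_holds G r}"
      by (auto simp: satisfied_rels_def)
    \<comment> \<open>Imposing all satisfied relations includes imposing the listed ones, which
      already cut out the image.\<close>
    have "listed_rels R \<subseteq> satisfied_rels (gmap ` R)"
      using image_satisfies_listed by (auto simp: satisfied_rels_def)
    then show "{G. \<forall>r \<in> satisfied_rels (gmap ` R). rect_holds G r} \<subseteq> gmap ` R"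
      using listed_imp_image by blast
  qed
  then show ?thesis
    using open_polytope_image image_eq_listed satisfied_rels_image
      image_eq_listed[unfolded listed_eq_iff_boxes] by blast
qed

end
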